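(* Let $\mathcal{X} = \mathcal{L}\cup\mathcal{U}$ be a finite set of $N$ points (labeled points $\mathcal{L}$, unlabeled points $\mathcal{U}$, disjoint), let $M\ge 2$ be the number of classes, and let $\tau_r\in(1/M,1)$. Let $(V^{(t)})_{t\ge 0}$ be the sequence of evidence matrices produced by Veracity Propagation (as defined in the context), let $c_i^{(t)}$ be the corresponding peakedness scores, and let $$\mathcal{F}_t=\mathcal{L}\cup\{x_i\in\mathcal{U}: c_i^{(t)}\ge\tau_r\},\qquad t\ge 0,$$ be the frozen sets. Let $T^\star$ be the smallest index $t\ge 0$ for which $\mathcal{F}_{t+1}=\mathcal{F}_t$. Then $T^\star$ exists and $$T^\star\;\le\;N-|\mathcal{F}_0|\;\le\;|\mathcal{U}|.$$ Consequently, propagation, which executes rounds $t=0,1,2,\dots$ (round $t$ computing $V^{(t+1)}$ from $V^{(t)}$) and halts after the first round $t$ with $\mathcal{F}_{t+1}=\mathcal{F}_t$, halts after at most $|\mathcal{U}|+1$ rounds.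
   Context: Setting. $\mathcal{X}=\mathcal{L}\cup\mathcal{U}=\{x_1,\dots,x_N\}$ is a finite set of points with embeddings $\phi(x_i)\in\mathbb{R}^d$; each labeled point $x_j\in\mathcal{L}$ has a class label $y_j\in\{1,\dots,M\}$. Points of $\mathcal{U}$ are unlabeled. Kernel. Let $K(x,x')=\exp(-\|\phi(x)-\phi(x')\|^2/(2\sigma^2))$ for a fixed $\sigma>0$. Fix a union-symmetrized $k$-nearest-neighbor graph on $\mathcal{X}$ without self-loops ($x_i,x_j$ are adjacent iff one is among the $k$ nearest neighbors of the other). Let $d_i=\sum_j K(x_i,x_j)$, the sum being over graph neighbors $x_j$ of $x_i$, and put $\hat K(x_i,x_j)=K(x_i,x_j)/\sqrt{\log(1+d_id_j)}$ if $x_i,x_j$ are adjacent and $\hat K(x_i,x_j)=0$ otherwise. Initial evidence. With a constant $\alpha_0>0$, $V^{(0)}\in\mathbb{R}^{N\times M}$ is $$V^{(0)}_{k,c}=\alpha_0+\sum_{x_j\in\mathcal{L},\ y_j=c}\hat K(x_j,x_k).$$ Normalized beliefs and peakedness. For each $t$, $\tilde V^{(t)}_{i,c}=V^{(t)}_{i,c}/\sum_{m=1}^M V^{(t)}_{i,m}$ and $c_i^{(t)}=\max_c\tilde V^{(t)}_{i,c}$. Roles at round $t$. Senders: $\mathcal{S}_t=\{x_i\in\mathcal{X}: c_i^{(t)}>1/M\}$. Receivers: $\mathcal{R}_t=\{x_i\in\mathcal{U}: c_i^{(t)}<\tau_r\}=\mathcal{X}\setminus\mathcal{F}_t$. A point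 may be both a sender and a receiver. Veracity Propagation update (all rows updated simultaneously). For $x_k\in\mathcal{R}_t$ and every class $c$, $$V^{(t+1)}_{k,c}=V^{(t)}_{k,c}+\sum_{x_s\in\mathcal{S}_t}V^{(t)}_{s,c}\,\hat K(x_s,x_k),$$ and for $x_k\in\mathcal{F}_t$ the row is left unchanged: $V^{(t+1)}_{k,c}=V^{(t)}_{k,c}$ for all $c$. For the purpose of defining $T^\star$, the sequence is regarded as continued for all $t\ge0$. *)

theory Defs
  imports "HOL-Analysis.Analysis" "HOL-Library.While_Combinator"
begin

definition gauss_kernel :: "real \<Rightarrow> ('p \<Rightarrow> real ^ 'd) \<Rightarrow> 'p \<Rightarrow> 'p \<Rightarrow> real" where
  "gauss_kernel \<sigma> \<phi> x x' = exp (- (norm (\<phi> x - \<phi> x'))\<^sup>2 / (2 * \<sigma>\<^sup>2))"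

(* nn x is a set of k nearest neighbours of x. Distance ties may be broken arbitrarily, so nn need
   not be unique. If fewer than k other points exist, all of them are neighbours. *)
definition nearest_neighbours ::
  "'p set \<Rightarrow> ('p \<Rightarrow> real ^ 'd) \<Rightarrow> nat \<Rightarrow> ('p \<Rightarrow> 'p set) \<Rightarrow> bool" where
  "nearest_neighbours X \<phi> k nn \<longleftrightarrow>
     (\<forall>x\<in>X. nn x \<subseteq> X - {x} \<and> card (nn x) = min k (card (X - {x})) \<and>
        (\<forall>u \<in> nn x. \<forall>v \<in> X - {x} - nn x. dist (\<phi> x) (\<phi> u) \<le> dist (\<phi> x) (\<phi> v)))"

definition knn_graph ::
  "'p set \<Rightarrow> ('p \<Rightarrow> real ^ 'd) \<Rightarrow> nat \<Rightarrow> ('p \<Rightarrow> 'p \<Rightarrow> bool) \<Rightarrow> bool" where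
  "knn_graph X \<phi> k adj \<longleftrightarrow>
     (\<exists>nn. nearest_neighbours X \<phi> k nn \<and>
        (\<forall>x x'. adj x x' \<longleftrightarrow> x \<in> X \<and> x' \<in> X \<and> (x' \<in> nn x \<or> x \<in> nn x')))"

definition kernel_degree ::
  "'p set \<Rightarrow> ('p \<Rightarrow> 'p \<Rightarrow> bool) \<Rightarrow> ('p \<Rightarrow> 'p \<Rightarrow> real) \<Rightarrow> 'p \<Rightarrow> real" where
  "kernel_degree X adj K x = (\<Sum>x' \<in> {x' \<in> X. adj x x'}. K x x')"

definition normalized_kernel ::
  "'p set \<Rightarrow> ('p \<Rightarrow> 'p \<Rightarrow> bool) \<Rightarrow> ('p \<Rightarrow> 'p \<Rightarrow> real) \<Rightarrow> 'p \<Rightarrow> 'p \<Rightarrow> real" where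
  "normalized_kernel X adj K x x' =
     (if adj x x'
      then K x x' / sqrt (ln (1 + kernel_degree X adj K x * kernel_degree X adj K x'))
      else 0)"

(* Evidence matrices are functions 'p => nat => real; only rows in L \<union> U and the
   columns 1, ..., M are meaningful. *)
definition initial_evidence ::
  "'p set \<Rightarrow> ('p \<Rightarrow> nat) \<Rightarrow> real \<Rightarrow> ('p \<Rightarrow> 'p \<Rightarrow> real) \<Rightarrow> 'p \<Rightarrow> nat \<Rightarrow> real" where
  "initial_evidence L y \<alpha> Kh x c = \<alpha> + (\<Sum>j \<in> {j \<in> L. y j = c}. Kh j x)"

definition normalized_belief :: "nat \<Rightarrow> ('p \<Rightarrow> nat \<Rightarrow> real) \<Rightarrow> 'p \<Rightarrow> nat \<Rightarrow> real" where
  "normalized_belief M V x c = V x c / (\<Sum>m=1..M. V x m)"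

definition peakedness :: "nat \<Rightarrow> ('p \<Rightarrow> nat \<Rightarrow> real) \<Rightarrow> 'p \<Rightarrow> real" where
  "peakedness M V x = Max (normalized_belief M V x ` {1..M})"

definition senders :: "nat \<Rightarrow> 'p set \<Rightarrow> 'p set \<Rightarrow> ('p \<Rightarrow> nat \<Rightarrow> real) \<Rightarrow> 'p set" where
  "senders M L U V = {x \<in> L \<union> U. peakedness M V x > 1 / real M}"

definition receivers :: "nat \<Rightarrow> real \<Rightarrow> 'p set \<Rightarrow> ('p \<Rightarrow> nat \<Rightarrow> real) \<Rightarrow> 'p set" where
  "receivers M \<tau> U V = {x \<in> U. peakedness M V x < \<tau>}"

definition frozen :: "nat \<Rightarrow> real \<Rightarrow> 'p set \<Rightarrow> 'p set \<Rightarrow> ('p \<Rightarrow> nat \<Rightarrow> real) \<Rightarrow> 'p set" where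
  "frozen M \<tau> L U V = L \<union> {x \<in> U. peakedness M V x \<ge> \<tau>}"

definition propagation_step ::
  "nat \<Rightarrow> real \<Rightarrow> 'p set \<Rightarrow> 'p set \<Rightarrow> ('p \<Rightarrow> 'p \<Rightarrow> real)
     \<Rightarrow> ('p \<Rightarrow> nat \<Rightarrow> real) \<Rightarrow> 'p \<Rightarrow> nat \<Rightarrow> real" where
  "propagation_step M \<tau> L U Kh V x c =
     (if x \<in> receivers M \<tau> U V
      then V x c + (\<Sum>s \<in> senders M L U V. V s c * Kh s x)
      else V x c)"

primrec evidence ::
  "nat \<Rightarrow> real \<Rightarrow> 'p set \<Rightarrow> 'p set \<Rightarrow> ('p \<Rightarrow> 'p \<Rightarrow> real)
     \<Rightarrow> ('p \<Rightarrow> nat \<Rightarrow> real) \<Rightarrow> nat \<Rightarrow> 'p \<Rightarrow> nat \<Rightarrow> real" where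
  "evidence M \<tau> L U Kh V0 0 = V0"
| "evidence M \<tau> L U Kh V0 (Suc t) = propagation_step M \<tau> L U Kh (evidence M \<tau> L U Kh V0 t)"

(* The procedure with its stopping test. A state holds the number of rounds executed so far, the
   current evidence matrix, and whether the last round left the frozen set unchanged.
   The value is None if the procedure never halts. *)
definition run_propagation ::
  "nat \<Rightarrow> real \<Rightarrow> 'p set \<Rightarrow> 'p set \<Rightarrow> ('p \<Rightarrow> 'p \<Rightarrow> real)
     \<Rightarrow> ('p \<Rightarrow> nat \<Rightarrow> real) \<Rightarrow> (nat \<times> ('p \<Rightarrow> nat \<Rightarrow> real) \<times> bool) option" where
  "run_propagation M \<tau> L U Kh V0 =
     while_option
       (\<lambda>(n, V, halted). \<not> halted)
       (\<lambda>(n, V, halted).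
          let V' = propagation_step M \<tau> L U Kh V
          in (Suc n, V', frozen M \<tau> L U V' = frozen M \<tau> L U V))
       (0, V0, False)"

end

theory Submission
  imports Defs
begin

text \<open>A frozen point is not a receiver, so its row, and with it its peakedness, never changes again.
  Hence the frozen sets increase, and a strictly increasing chain of subsets of a finite set that
  starts at \<open>F 0\<close> has at most \<open>N - card (F 0)\<close> steps.\<close>

lemma card_strict_chain:
  fixes F :: "nat \<Rightarrow> 'a set"
  assumes "finite X" and "\<And>t. F t \<subseteq> X" and mono: "\<And>t. F t \<subseteq> F (Suc t)"
    and "\<And>t. t < n \<Longrightarrow> F (Suc t) \<noteq> F t"
  shows "card (F 0) + n \<le> card (F n)"
  using assms(4)
proof (induction n)
  case (Suc n)
  have "F n \<subset> F (Suc n)"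
    using mono[of n] Suc.prems[of n] by auto
  then have "card (F n) < card (F (Suc n))"
    using assms(1,2) by (meson finite_subset psubset_card_mono)
  moreover have "card (F 0) + n \<le> card (F n)"
    using Suc by simp
  ultimately show ?case by simp
qed simp

text \<open>Up to the first stable index every inclusion is strict, so the chain bound limits that
  index; only its existence needs a separate argument.\<close>

lemma increasing_sets_stabilize:
  fixes F :: "nat \<Rightarrow> 'a set"
  assumes "finite X" and "\<And>t. F t \<subseteq> X" and "\<And>t. F t \<subseteq> F (Suc t)"
  obtains t where "F (Suc t) = F t" and "card (F 0) + t \<le> card X"
proof -
  have bound: "card (F 0) + n \<le> card X" if "\<And>t. t < n \<Longrightarrow> F (Suc t) \<noteq> F t" for n
  proof -
    have "card (F 0) + n \<le> card (F n)"
      using assms that by (rule card_strict_chain)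
    also have "\<dots> \<le> card X"
      using assms(1,2) by (rule card_mono)
    finally show ?thesis .
  qed
  have ex: "\<exists>t. F (Suc t) = F t"
    \<comment> \<open>If no index were stable, \<open>bound\<close> would hold for every
      \<open>n\<close>; it already fails for a chain longer than \<open>card X\<close>.\<close>
    using bound[of "Suc (card X)"] by auto
  show ?thesis
  proof (rule that)
    show "F (Suc (LEAST t. F (Suc t) = F t)) = F (LEAST t. F (Suc t) = F t)"
      by (rule LeastI_ex[OF ex])
    show "card (F 0) + (LEAST t. F (Suc t) = F t) \<le> card X"
      by (rule bound) (rule not_less_Least)
  qed
qed

lemma peakedness_cong:
  assumes "V x = W x"
  shows "peakedness M V x = peakedness M W x"
  using assms by (simp add: peakedness_def normalized_belief_def cong: image_cong)

lemma propagation_step_non_receiver: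
  assumes "x \<notin> receivers M \<tau> U V"
  shows "propagation_step M \<tau> L U Kh V x = V x"
  using assms by (simp add: propagation_step_def fun_eq_iff)

lemma frozen_subset: "frozen M \<tau> L U V \<subseteq> L \<union> U"
  by (auto simp: frozen_def)

lemma frozen_subset_step:
  "frozen M \<tau> L U V \<subseteq> frozen M \<tau> L U (propagation_step M \<tau> L U Kh V)"
proof
  fix x assume x: "x \<in> frozen M \<tau> L U V"
  show "x \<in> frozen M \<tau> L U (propagation_step M \<tau> L U Kh V)"
  proof (cases "x \<in> L")
    case False
    then have "x \<notin> receivers M \<tau> U V"
      using x by (auto simp: frozen_def receivers_def)
    then have "peakedness M (propagation_step M \<tau> L U Kh V) x = peakedness M V x"
      by (intro peakedness_cong propagation_step_non_receiver)
    then show ?thesis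
      using x by (simp add: frozen_def)
  qed (simp add: frozen_def)
qed

text \<open>The loop iterates have a closed form in terms of \<open>evidence\<close>, so the halting
  test can be read off \<open>F\<close>. The index \<open>t\<close> need not be the first stable
  one, hence only an upper bound on \<open>n\<close>.\<close>

lemma run_propagation_halts:
  fixes V0 :: "'p \<Rightarrow> nat \<Rightarrow> real" and F :: "nat \<Rightarrow> 'p set"
  assumes F_def: "F = (\<lambda>t. frozen M \<tau> L U (evidence M \<tau> L U Kh V0 t))"
    and stable: "F (Suc t) = F t"
  shows "\<exists>n W. run_propagation M \<tau> L U Kh V0 = Some (n, W, True) \<and> n \<le> Suc t"
proof -
  define b :: "nat \<times> ('p \<Rightarrow> nat \<Rightarrow> real) \<times> bool \<Rightarrow> bool"
    where "b = (\<lambda>(n, V, halted). \<not> halted)"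
  define c where "c = (\<lambda>(n :: nat, V :: 'p \<Rightarrow> nat \<Rightarrow> real, halted :: bool).
    let V' = propagation_step M \<tau> L U Kh V
    in (Suc n, V', frozen M \<tau> L U V' = frozen M \<tau> L U V))"
  define s :: "nat \<times> ('p \<Rightarrow> nat \<Rightarrow> real) \<times> bool" where "s = (0, V0, False)"
  \<comment> \<open>The conjunct \<open>n > 0\<close> reproduces the initial flag
    \<open>False\<close>: at \<open>n = 0\<close> truncated subtraction would make
    \<open>F n = F (n - 1)\<close> true.\<close>
  have iterate: "(c ^^ n) s = (n, evidence M \<tau> L U Kh V0 n, n > 0 \<and> F n = F (n - 1))" for n
    by (induction n) (simp_all add: s_def c_def F_def Let_def)
  let ?n = "LEAST n. \<not> b ((c ^^ n) s)"
  have stop: "\<not> b ((c ^^ Suc t) s)"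
    unfolding iterate b_def using stable by simp
  have "run_propagation M \<tau> L U Kh V0 = while_option b c s"
    by (simp only: run_propagation_def b_def c_def s_def)
  also have "\<dots> = Some ((c ^^ ?n) s)"
    \<comment> \<open>By definition, \<open>while_option\<close> returns the iterate at the least
      index where the guard fails, provided such an index exists.\<close>
    using stop unfolding while_option_def by metis
  also have "\<dots> = Some (?n, evidence M \<tau> L U Kh V0 ?n, True)"
    using LeastI[of "\<lambda>n. \<not> b ((c ^^ n) s)", OF stop] iterate[of ?n] by (simp add: b_def)
  finally show ?thesis
    using Least_le[of "\<lambda>n. \<not> b ((c ^^ n) s)", OF stop] by blast
qed

theorem proposition3p1:
  fixes L U :: "'p set" and \<phi> :: "'p \<Rightarrow> real ^ 'd" and y :: "'p \<Rightarrow> nat"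
    and M N k Tstar :: nat and \<sigma> \<alpha>\<^sub>0 \<tau>\<^sub>r :: real
    and adj :: "'p \<Rightarrow> 'p \<Rightarrow> bool" and Kh :: "'p \<Rightarrow> 'p \<Rightarrow> real"
    and V0 :: "'p \<Rightarrow> nat \<Rightarrow> real" and V :: "nat \<Rightarrow> 'p \<Rightarrow> nat \<Rightarrow> real" and F :: "nat \<Rightarrow> 'p set"
  assumes "finite (L \<union> U)" and "L \<inter> U = {}" and "N = card (L \<union> U)"
    and "M \<ge> 2" and "y ` L \<subseteq> {1..M}"
    and "\<sigma> > 0" and "\<alpha>\<^sub>0 > 0" and "1 / real M < \<tau>\<^sub>r" and "\<tau>\<^sub>r < 1"
    and "knn_graph (L \<union> U) \<phi> k adj"
    and "Kh = normalized_kernel (L \<union> U) adj (gauss_kernel \<sigma> \<phi>)"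
    and "V0 = initial_evidence L y \<alpha>\<^sub>0 Kh"
    and "V = evidence M \<tau>\<^sub>r L U Kh V0"
    and "F = (\<lambda>t. frozen M \<tau>\<^sub>r L U (V t))"
    and "Tstar = (LEAST t. F (t + 1) = F t)"
  shows "(\<exists>t. F (t + 1) = F t)
    \<and> int Tstar \<le> int N - int (card (F 0))
    \<and> int N - int (card (F 0)) \<le> int (card U)
    \<and> (\<exists>n W. run_propagation M \<tau>\<^sub>r L U Kh V0 = Some (n, W, True) \<and> n \<le> card U + 1)"
proof -
  have sub: "F t \<subseteq> L \<union> U" for t
    unfolding assms(14) by (rule frozen_subset)
  have mono: "F t \<subseteq> F (Suc t)" for t
    unfolding assms(13,14) by (simp add: frozen_subset_step)
  obtain t where t: "F (Suc t) = F t" and le: "card (F 0) + t \<le> N"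
    using increasing_sets_stabilize[of "L \<union> U" F, OF assms(1) sub mono] assms(3) by auto
  have "Tstar \<le> t"
    using t unfolding assms(15) by (simp add: Least_le)
  then have Tstar: "int Tstar \<le> int N - int (card (F 0))"
    using le by simp
  have "N = card L + card U"
    using assms(1-3) by (simp add: card_Un_disjoint)
  \<comment> \<open>Labeled points are frozen from the start, so at most \<open>card U\<close>
    points remain to be frozen.\<close>
  moreover have "card L \<le> card (F 0)"
    using finite_subset[OF sub assms(1)] by (intro card_mono) (auto simp: assms(14) frozen_def)
  ultimately have U: "int N - int (card (F 0)) \<le> int (card U)"
    by simp
  \<comment> \<open>Rounds are numbered from 0: stability at index \<open>t\<close> is detected by
    round \<open>t\<close>, the \<open>Suc t\<close>-th one executed. This is the extra 1 in the
    bound.\<close>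
  obtain n W where run: "run_propagation M \<tau>\<^sub>r L U Kh V0 = Some (n, W, True)" and n: "n \<le> Suc t"
    using run_propagation_halts[of F, OF assms(14)[unfolded assms(13)] t] by blast
  have "n \<le> card U + 1"
    using n le U by linarith
  then show ?thesis
    using t Tstar U run by auto
qed

end
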